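(* Let $f,g\in F^2$ and suppose that $|f(z)|\le|g(z)|$ for all $z\in\mathbb C$ with $|z|>1$. Then $\|f\|\le\|g\|$. Moreover, $\|f\|=\|g\|$ if and only if either $f=\eta g$ for a unimodular constant $\eta$ (that is, $\eta\in\mathbb C$, $|\eta|=1$), or $$f(z)=c\,(\eta+az),\qquad g(z)=c\,(z+\bar a\eta)\qquad(z\in\mathbb C)$$ for some $c\in\mathbb C$, some $\eta\in\mathbb C$ with $|\eta|=1$ and some $a\in\mathbb C$ with $|a|<1$.
   Context: $dA$ denotes area (Lebesgue) measure on $\mathbb C$. For an entire function $f$ put $\|f\|^2=\frac1\pi\int_{\mathbb C}|f(z)|^2e^{-|z|^2}\,dA(z)$. The Fock space is $F^2=\{f\text{ entire}:\|f\|<\infty\}$. *)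

theory Defs
  imports "HOL-Complex_Analysis.Complex_Analysis"
begin

text \<open>
  \<^term>\<open>lborel\<close> on type \<^typ>\<open>complex\<close> is area measure.  The integral is the Bochner integral, which is
  0 for a non-integrable function, so \<open>fock_norm f\<close> is meaningful only for \<open>f \<in> fock_space\<close>;
  finiteness of the norm is expressed by integrability in \<open>fock_space\<close>.
\<close>

definition fock_norm :: "(complex \<Rightarrow> complex) \<Rightarrow> real" where
  "fock_norm f = sqrt (1 / pi * (LINT z|lborel. (cmod (f z))\<^sup>2 * exp (- (cmod z)\<^sup>2)))"

definition fock_space :: "(complex \<Rightarrow> complex) set" where
  "fock_space = {f. f holomorphic_on UNIV \<and>
     integrable lborel (\<lambda>z. (cmod (f z))\<^sup>2 * exp (- (cmod z)\<^sup>2))}"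

end

theory Submission
  imports Defs "HOL-Probability.Distributions"
begin

text \<open>
  Let \<open>a\<^sub>n\<close>, \<open>b\<^sub>n\<close> be the Taylor coefficients of \<open>f\<close>, \<open>g\<close> and \<open>p\<^sub>n = |b\<^sub>n|\<^sup>2 - |a\<^sub>n|\<^sup>2\<close>, so that
  \<open>\<parallel>g\<parallel>\<^sup>2 - \<parallel>f\<parallel>\<^sup>2 = \<Sum>n. n! p\<^sub>n\<close>.  The quotient \<open>f / g\<close> extends to a holomorphic function on \<open>|z| > 1\<close>,
  including \<open>\<infinity>\<close>, that is bounded by 1.  It has only nonpositive powers of \<open>z\<close>, so the tail of \<open>f\<close> from
  degree \<open>m\<close> on is the projection of the quotient times the tail of \<open>g\<close>; this makes every tail sum
  \<open>T\<^sub>m = \<Sum>n\<ge>m. p\<^sub>n\<close> nonnegative.  Summation by parts gives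
  \<open>\<parallel>g\<parallel>\<^sup>2 - \<parallel>f\<parallel>\<^sup>2 = T\<^sub>0 + \<Sum>m\<ge>2. (m! - (m-1)!) T\<^sub>m\<close>, where \<open>T\<^sub>1\<close> has weight \<open>1! - 0! = 0\<close>.  In the case of
  equality \<open>T\<^sub>0 = T\<^sub>2 = T\<^sub>3 = \<dots> = 0\<close>: if some \<open>b\<^sub>m \<noteq> 0\<close> with \<open>m \<ge> 2\<close>, then \<open>f / g\<close> is the constant
  \<open>a\<^sub>m / b\<^sub>m\<close>, and otherwise \<open>f\<close> and \<open>g\<close> are affine.
\<close>

subsection \<open>Area measure on the complex plane\<close>

text \<open>Lebesgue measure is determined by its values on boxes, and a complex box is a product of
  two real intervals. This gives access to Tonelli's theorem in real coordinates.\<close>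

lemma lborel_complex_eq_distr:
  "(lborel :: complex measure) = distr (lborel \<Otimes>\<^sub>M lborel) borel (\<lambda>(x, y). Complex x y)"
proof (rule lborel_eqI)
  have m: "(\<lambda>(x, y). Complex x y) \<in> borel_measurable (lborel \<Otimes>\<^sub>M lborel)"
    unfolding Complex_eq by measurable
  fix l u :: complex assume "\<And>b. b \<in> Basis \<Longrightarrow> l \<bullet> b \<le> u \<bullet> b"
  from this[of 1] this[of \<i>] have le: "Re l \<le> Re u" "Im l \<le> Im u"
    by (auto simp: Basis_complex_def)
  have "(\<lambda>(x, y). Complex x y) -` box l u = {Re l<..<Re u} \<times> {Im l<..<Im u}"
    by (auto simp: box_def Basis_complex_def)
  then show "emeasure (distr (lborel \<Otimes>\<^sub>M lborel) borel (\<lambda>(x, y). Complex x y)) (box l u) =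
      ennreal (\<Prod>b\<in>Basis. (u - l) \<bullet> b)"
    using le by (simp add: emeasure_distr m space_pair_measure lborel.emeasure_pair_measure_Times
      Basis_complex_def ennreal_mult)
qed simp

text \<open>Both orders of integration are needed: each shear below translates one real coordinate,
  which then has to be the inner variable.\<close>

lemma nn_integral_lborel_complex:
  assumes [measurable]: "u \<in> borel_measurable borel"
  shows "(\<integral>\<^sup>+z. u z \<partial>lborel) = (\<integral>\<^sup>+x. \<integral>\<^sup>+y. u (Complex x y) \<partial>lborel \<partial>lborel)"
    and "(\<integral>\<^sup>+z. u z \<partial>lborel) = (\<integral>\<^sup>+y. \<integral>\<^sup>+x. u (Complex x y) \<partial>lborel \<partial>lborel)"
proof -
  have m[measurable]: "(\<lambda>(x, y). Complex x y) \<in> borel_measurable (lborel \<Otimes>\<^sub>M lborel)"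
    unfolding Complex_eq by measurable
  have "(\<integral>\<^sup>+z. u z \<partial>lborel) = (\<integral>\<^sup>+p. u (case p of (x, y) \<Rightarrow> Complex x y) \<partial>(lborel \<Otimes>\<^sub>M lborel))"
    by (subst lborel_complex_eq_distr, subst nn_integral_distr) auto
  also have "\<dots> = (\<integral>\<^sup>+x. \<integral>\<^sup>+y. u (Complex x y) \<partial>lborel \<partial>lborel)"
    by (subst lborel.nn_integral_fst[symmetric]) auto
  finally show 1: "(\<integral>\<^sup>+z. u z \<partial>lborel) = (\<integral>\<^sup>+x. \<integral>\<^sup>+y. u (Complex x y) \<partial>lborel \<partial>lborel)" .
  also have "\<dots> = (\<integral>\<^sup>+y. \<integral>\<^sup>+x. u (Complex x y) \<partial>lborel \<partial>lborel)"
    by (rule lborel_pair.Fubini') measurable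
  finally show "(\<integral>\<^sup>+z. u z \<partial>lborel) = (\<integral>\<^sup>+y. \<integral>\<^sup>+x. u (Complex x y) \<partial>lborel \<partial>lborel)" .
qed

text \<open>With the other coordinate fixed, a shear is a translation of a real line, so the inner
  integral is unchanged.\<close>

lemma nn_integral_lborel_shear:
  fixes a :: real
  assumes [measurable]: "u \<in> borel_measurable borel"
  shows "(\<integral>\<^sup>+z. u (z + of_real (a * Im z)) \<partial>lborel) = (\<integral>\<^sup>+z. u z \<partial>lborel)"
    and "(\<integral>\<^sup>+z. u (z + \<i> * of_real (a * Re z)) \<partial>lborel) = (\<integral>\<^sup>+z. u z \<partial>lborel)"
proof -
  have [measurable]: "(\<lambda>x. u (Complex x y)) \<in> borel_measurable borel"
      "(\<lambda>x. u (Complex y x)) \<in> borel_measurable borel" for y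
    unfolding Complex_eq by measurable
  have "(\<integral>\<^sup>+z. u (z + of_real (a * Im z)) \<partial>lborel) =
      (\<integral>\<^sup>+y. \<integral>\<^sup>+x. u (Complex (a * y + 1 * x) y) \<partial>lborel \<partial>lborel)"
    by (subst nn_integral_lborel_complex(2)) (auto simp: Complex_eq algebra_simps)
  also have "\<dots> = (\<integral>\<^sup>+y. \<integral>\<^sup>+x. u (Complex x y) \<partial>lborel \<partial>lborel)"
    using nn_integral_real_affine[of "\<lambda>x. u (Complex x y)" 1 "a * y" for y] by simp
  finally show "(\<integral>\<^sup>+z. u (z + of_real (a * Im z)) \<partial>lborel) = (\<integral>\<^sup>+z. u z \<partial>lborel)"
    by (subst nn_integral_lborel_complex(2)) auto
  have "(\<integral>\<^sup>+z. u (z + \<i> * of_real (a * Re z)) \<partial>lborel) =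
      (\<integral>\<^sup>+x. \<integral>\<^sup>+y. u (Complex x (a * x + 1 * y)) \<partial>lborel \<partial>lborel)"
    by (subst nn_integral_lborel_complex(1)) (auto simp: Complex_eq algebra_simps)
  also have "\<dots> = (\<integral>\<^sup>+x. \<integral>\<^sup>+y. u (Complex x y) \<partial>lborel \<partial>lborel)"
    using nn_integral_real_affine[of "\<lambda>y. u (Complex x y)" 1 "a * x" for x] by simp
  finally show "(\<integral>\<^sup>+z. u (z + \<i> * of_real (a * Re z)) \<partial>lborel) = (\<integral>\<^sup>+z. u z \<partial>lborel)"
    by (subst nn_integral_lborel_complex(1)) auto
qed

text \<open>A rotation other than \<open>z \<mapsto> - z\<close> is a product of three shears; its square covers the
  excluded one.\<close>

lemma nn_integral_lborel_rotation:
  assumes [measurable]: "u \<in> borel_measurable borel" and c: "cmod c = 1"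
  shows "(\<integral>\<^sup>+z. u (c * z) \<partial>lborel) = (\<integral>\<^sup>+z. u z \<partial>lborel)"
proof -
  have rot: "(\<integral>\<^sup>+z. v (s * z) \<partial>lborel) = (\<integral>\<^sup>+z. v z \<partial>lborel)"
    if [measurable]: "v \<in> borel_measurable borel" and s: "cmod s = 1" "Re s \<noteq> - 1" for v s
  proof -
    \<comment> \<open>For \<open>s = cis t\<close> this is \<open>- tan (t / 2)\<close>. Horizontal,
      vertical and horizontal shears with slopes \<open>a\<close>, \<open>sin t\<close> and
      \<open>a\<close> compose to the rotation by \<open>t\<close>.\<close>
    define a where "a = - Im s / (1 + Re s)"
    have n: "1 + Re s \<noteq> 0" using s by auto
    have 1: "(Re s)\<^sup>2 + (Im s)\<^sup>2 = 1"
      using s by (simp add: cmod_def)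
    have 2: "a * (1 + Re s) = - Im s" "a * Im s = Re s - 1"
      using n 1 by (auto simp: a_def field_simps power2_eq_square)
    define H where "H = (\<lambda>z::complex. z + of_real (a * Im z))"
    define V where "V = (\<lambda>z::complex. z + \<i> * of_real (Im s * Re z))"
    have [measurable]: "H \<in> borel_measurable borel" "V \<in> borel_measurable borel"
      unfolding H_def V_def by measurable
    have "s * z = H (V (H z))" for z
    proof -
      have x: "Re s = 1 + a * Im s" using 2 by simp
      have "Im s = - a * (1 + Re s)" using 2 by simp
      then have y: "- Im s = 2 * a + a * a * Im s" unfolding x by (simp add: algebra_simps)
      have "Re z * Re s - Im z * Im s = Re z * (1 + a * Im s) + Im z * (2 * a + a * a * Im s)"
        using x y by algebra
      then show ?thesis
        unfolding H_def V_def by (simp add: complex_eq_iff x algebra_simps)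
    qed
    then have "(\<integral>\<^sup>+z. v (s * z) \<partial>lborel) = (\<integral>\<^sup>+z. v (H (V (H z))) \<partial>lborel)" by simp
    also have "\<dots> = (\<integral>\<^sup>+z. v (H (V z)) \<partial>lborel)"
      using nn_integral_lborel_shear(1)[of "\<lambda>z. v (H (V z))" a] by (simp add: H_def)
    also have "\<dots> = (\<integral>\<^sup>+z. v (H z) \<partial>lborel)"
      using nn_integral_lborel_shear(2)[of "\<lambda>z. v (H z)" "Im s"] by (simp add: V_def)
    also have "\<dots> = (\<integral>\<^sup>+z. v z \<partial>lborel)"
      using nn_integral_lborel_shear(1)[of v a] by (simp add: H_def)
    finally show ?thesis .
  qed
  \<comment> \<open>The principal square root has nonnegative real part, hence is never
    \<open>- 1\<close>; the rotation by \<open>c\<close> is the rotation by \<open>s\<close> done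
    twice.\<close>
  define s where "s = csqrt c"
  have "0 \<le> Re s"
    unfolding s_def using csqrt_principal[of c] by linarith
  then have s: "s * s = c" "cmod s = 1" "Re s \<noteq> - 1"
    using c by (auto simp: s_def simp del: csqrt.sel simp flip: power2_eq_square)
  have "(\<integral>\<^sup>+z. u (c * z) \<partial>lborel) = (\<integral>\<^sup>+z. u (s * (s * z)) \<partial>lborel)"
    using s by (simp add: mult.assoc[symmetric])
  also have "\<dots> = (\<integral>\<^sup>+z. u (s * z) \<partial>lborel)"
    using rot[of "\<lambda>z. u (s * z)" s] s by simp
  also have "\<dots> = (\<integral>\<^sup>+z. u z \<partial>lborel)"
    by (rule rot) (use s in auto)
  finally show ?thesis .
qed

text \<open>The disc of radius \<open>sqrt x\<close> has area \<open>pi * x\<close>, and the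
  half-lines \<open>{..x}\<close> determine a measure. Together with averaging over rotations this
  replaces polar coordinates.\<close>

lemma distr_norm_square_lborel_complex:
  "distr lborel borel (\<lambda>z::complex. (cmod z)\<^sup>2) = density lborel (\<lambda>s. ennreal pi * indicator {0..} s)"
  (is "?M = ?N")
proof (rule measure_eqI_generator_eq[where E = "range atMost" and \<Omega> = UNIV and A = "\<lambda>i. {..real i}"])
  have M: "emeasure ?M {..x} = ennreal pi * ennreal x" for x
  proof -
    have "(\<lambda>z::complex. (cmod z)\<^sup>2) -` {..x} = (if 0 \<le> x then cball 0 (sqrt x) else {})"
      by (auto simp: real_le_rsqrt dest: real_le_lsqrt[rotated -1] order_trans[OF zero_le_power2])
        (metis norm_ge_zero power_mono real_sqrt_pow2)
    then show ?thesis
      by (auto simp: emeasure_distr emeasure_cball unit_ball_vol_2 ennreal_mult' ennreal_neg)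
  qed
  show "emeasure ?M X = emeasure ?N X" if X: "X \<in> range atMost" for X
  proof -
    obtain x where x: "X = {..x}" using X by auto
    have "emeasure ?N X = (\<integral>\<^sup>+s. ennreal pi * indicator {0..x} s \<partial>lborel)"
      unfolding x by (subst emeasure_density) (auto intro!: nn_integral_cong split: split_indicator)
    also have "\<dots> = ennreal pi * ennreal x"
      by (subst nn_integral_cmult) (cases "0 \<le> x"; simp add: ennreal_neg)+
    finally show ?thesis
      unfolding x M by simp
  qed
  show "emeasure ?M {..real i} \<noteq> \<infinity>" for i
    by (simp add: M ennreal_mult_eq_top_iff)
  show "Int_stable (range (atMost :: real \<Rightarrow> _))"
    by (auto simp: Int_stable_def)
  show "(\<Union>i. {..real i}) = UNIV"
    by (auto intro: real_arch_simple)
qed (auto simp: borel_eq_atMost)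

text \<open>The substitution of \<open>s\<close> for the squared modulus turns the integral into
  \<open>pi\<close> times Euler's integral for \<open>fact n\<close>.\<close>

lemma nn_integral_gaussian_moment:
  "(\<integral>\<^sup>+z. ennreal ((cmod z) ^ (2 * n) * exp (- (cmod z)\<^sup>2)) \<partial>lborel) = ennreal (pi * fact n)"
proof -
  have "(\<integral>\<^sup>+z. ennreal ((cmod z) ^ (2 * n) * exp (- (cmod z)\<^sup>2)) \<partial>lborel) =
      (\<integral>\<^sup>+s. ennreal (s ^ n * exp (- s)) \<partial>distr lborel borel (\<lambda>z::complex. (cmod z)\<^sup>2))"
    by (subst nn_integral_distr) (auto simp: power_mult)
  also have "\<dots> = (\<integral>\<^sup>+s. ennreal pi * (ennreal (s ^ n * exp (- s)) * indicator {0..} s) \<partial>lborel)"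
    unfolding distr_norm_square_lborel_complex
    by (subst nn_integral_density) (auto intro!: nn_integral_cong simp: mult_ac)
  also have "\<dots> = ennreal (pi * fact n)"
    by (subst nn_integral_cmult) (auto simp: nn_intergal_power_times_exp_Ici ennreal_mult')
  finally show ?thesis .
qed

subsection \<open>Means over the unit circle\<close>

text \<open>Integration against normalised arc length: the parameter runs over an interval of length
  1, so there is no factor \<open>1 / (2 * pi)\<close>. Real and complex means are both
  taken.\<close>

definition circle_mean :: "(complex \<Rightarrow> 'a::banach) \<Rightarrow> 'a" where
  "circle_mean u = integral {0..1} (\<lambda>t. u (cis (2 * pi * t)))"

lemma continuous_on_circle_compose:
  assumes "continuous_on (sphere 0 1) u"
  shows "continuous_on {0..1} (\<lambda>t::real. u (cis (2 * pi * t)))"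
  by (rule continuous_on_compose2[OF assms]) (auto intro!: continuous_intros)

lemma circle_mean_add:
  assumes "continuous_on (sphere 0 1) u" "continuous_on (sphere 0 1) v"
  shows "circle_mean (\<lambda>x. u x + v x) = circle_mean u + circle_mean v"
  unfolding circle_mean_def
  by (intro integral_add integrable_continuous_real continuous_on_circle_compose assms)

lemma circle_mean_Re:
  assumes "continuous_on (sphere 0 1) u"
  shows "circle_mean (\<lambda>x. 2 * Re (u x)) = 2 * Re (circle_mean u)"
  using integral_linear[OF integrable_continuous_real[OF continuous_on_circle_compose[OF assms]]
    bounded_linear_Re]
  by (simp add: circle_mean_def o_def)

lemma circle_mean_cong:
  assumes "\<And>x. cmod x = 1 \<Longrightarrow> u x = v x"
  shows "circle_mean u = circle_mean v"
  unfolding circle_mean_def by (intro integral_cong) (simp add: assms)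

lemma circle_mean_const [simp]: "circle_mean (\<lambda>x. c) = c"
  by (simp add: circle_mean_def)

lemma circle_mean_mono:
  fixes u v :: "complex \<Rightarrow> real"
  assumes "continuous_on (sphere 0 1) u" "continuous_on (sphere 0 1) v"
    "\<And>x. cmod x = 1 \<Longrightarrow> u x \<le> v x"
  shows "circle_mean u \<le> circle_mean v"
  unfolding circle_mean_def using assms(3)
  by (intro integral_le integrable_continuous_real continuous_on_circle_compose assms) auto

text \<open>A continuous nonnegative function with integral 0 vanishes along the parametrisation,
  which reaches every unimodular point.\<close>

lemma circle_mean_eq_0D:
  fixes u :: "complex \<Rightarrow> real"
  assumes "continuous_on (sphere 0 1) u" "\<And>x. cmod x = 1 \<Longrightarrow> 0 \<le> u x"
    and "circle_mean u = 0" "cmod x = 1"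
  shows "u x = 0"
proof -
  have "\<forall>t\<in>{0..1}. u (cis (2 * pi * t)) = 0"
    using assms(3) unfolding circle_mean_def
    by (subst (asm) integral_eq_0_iff) (auto intro!: continuous_on_circle_compose assms)
  moreover obtain t where t: "0 \<le> t" "t < 2 * pi" "x = Complex (cos t) (sin t)"
    using complex_unimodular_polar[OF \<open>cmod x = 1\<close>] by blast
  moreover from t have "x = cis (2 * pi * (t / (2 * pi)))" "t / (2 * pi) \<in> {0..1}"
    by (auto simp: cis.ctr)
  ultimately show ?thesis by metis
qed

text \<open>Cauchy's integral formula at the centre: on the unit circle the form
  \<open>dz / z\<close> equals \<open>2 * pi * \<i>\<close> times \<open>dt\<close>.\<close>

lemma circle_mean_holomorphic:
  assumes "h holomorphic_on cball 0 1"
  shows "circle_mean h = h 0"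
proof -
  have "((\<lambda>u. h u / (u - 0)) has_contour_integral (2 * of_real pi * \<i> * h 0)) (circlepath 0 1)"
    by (rule Cauchy_integral_circlepath_simple[OF assms]) simp
  then have "((\<lambda>t. h (circlepath 0 1 t) / circlepath 0 1 t *
      vector_derivative (circlepath 0 1) (at t within {0..1})) has_integral
      (2 * of_real pi * \<i> * h 0)) {0..1}"
    by (simp add: has_contour_integral_def)
  then have "((\<lambda>t. (2 * of_real pi * \<i>) * h (cis (2 * pi * t))) has_integral
      (2 * of_real pi * \<i> * h 0)) {0..1}"
    by (rule has_integral_eq[rotated])
      (auto simp: vector_derivative_circlepath01, simp add: circlepath cis_conv_exp mult_ac)
  from has_integral_mult_right[OF this, of "inverse (2 * of_real pi * \<i>)"]
  show ?thesis
    by (simp add: circle_mean_def integral_unique field_simps)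
qed

text \<open>The mean value property is applied to the holomorphic function
  \<open>cnj \<circ> h \<circ> cnj\<close>. The lemma serves for functions of \<open>1 / z\<close>,
  which on the circle are functions of \<open>cnj z\<close>.\<close>

lemma circle_mean_holomorphic_cnj:
  assumes h: "h holomorphic_on ball 0 R" and "1 < R"
  shows "circle_mean (\<lambda>x. h (cnj x)) = h 0"
proof -
  have "circle_mean (\<lambda>x. cnj (cnj (h (cnj x)))) = cnj (circle_mean (cnj \<circ> h \<circ> cnj))"
    unfolding circle_mean_def by (simp add: integral_cnj)
  also have "circle_mean (cnj \<circ> h \<circ> cnj) = (cnj \<circ> h \<circ> cnj) 0"
  proof (rule circle_mean_holomorphic)
    have "cnj ` ball 0 R = ball 0 R"
      by (auto simp: image_iff intro!: bexI[of _ "cnj _"])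
    then have "cnj \<circ> h \<circ> cnj holomorphic_on ball 0 R"
      using h by (intro holomorphic_on_compose_cnj_cnj) auto
    then show "cnj \<circ> h \<circ> cnj holomorphic_on cball 0 1"
      by (rule holomorphic_on_subset) (use \<open>1 < R\<close> in auto)
  qed
  finally show ?thesis by simp
qed

text \<open>Pythagoras for functions that are orthogonal on the circle.\<close>

lemma circle_mean_norm_add:
  fixes u v :: "complex \<Rightarrow> complex"
  assumes u: "continuous_on (sphere 0 1) u" and v: "continuous_on (sphere 0 1) v"
    and 0: "circle_mean (\<lambda>x. u x * cnj (v x)) = 0"
  shows "circle_mean (\<lambda>x. (cmod (u x + v x))\<^sup>2) =
    circle_mean (\<lambda>x. (cmod (u x))\<^sup>2) + circle_mean (\<lambda>x. (cmod (v x))\<^sup>2)"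
proof -
  have c: "continuous_on (sphere 0 1) (\<lambda>x. u x * cnj (v x))"
    by (intro continuous_intros u v)
  have "circle_mean (\<lambda>x. (cmod (u x + v x))\<^sup>2) =
      circle_mean (\<lambda>x. ((cmod (u x))\<^sup>2 + (cmod (v x))\<^sup>2) + 2 * Re (u x * cnj (v x)))"
    by (rule circle_mean_cong) (unfold cmod_power2, simp add: power2_eq_square algebra_simps)
  also have "\<dots> = circle_mean (\<lambda>x. (cmod (u x))\<^sup>2) + circle_mean (\<lambda>x. (cmod (v x))\<^sup>2) +
      circle_mean (\<lambda>x. 2 * Re (u x * cnj (v x)))"
    by (subst circle_mean_add circle_mean_add; (intro continuous_intros u v)?)+ simp
  also have "circle_mean (\<lambda>x. 2 * Re (u x * cnj (v x))) = 2 * Re (circle_mean (\<lambda>x. u x * cnj (v x)))"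
    by (rule circle_mean_Re[OF c])
  finally show ?thesis using 0 by simp
qed

section \<open>Entire power series and Parseval's identity\<close>

definition entire_coeffs :: "(nat \<Rightarrow> complex) \<Rightarrow> bool" where
  "entire_coeffs a \<longleftrightarrow> (\<forall>z. summable (\<lambda>n. a n * z ^ n))"

definition powser :: "(nat \<Rightarrow> complex) \<Rightarrow> complex \<Rightarrow> complex" where
  "powser a z = (\<Sum>n. a n * z ^ n)"

text \<open>Convergence at the strictly larger radius \<open>\<bar>r\<bar> + 1\<close> gives
  absolute convergence at \<open>r\<close>.\<close>

lemma entire_coeffs_norm:
  assumes "entire_coeffs a"
  shows "summable (\<lambda>n. cmod (a n) * r ^ n)"
proof -
  have "summable (\<lambda>n. norm (a n * of_real r ^ n))"
    by (rule powser_insidea[of _ "of_real (\<bar>r\<bar> + 1)"])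
      (use assms in \<open>auto simp: entire_coeffs_def simp del: of_real_add\<close>)
  then have "summable (\<lambda>n. \<bar>cmod (a n) * r ^ n\<bar>)"
    by (simp add: norm_mult norm_power abs_mult power_abs)
  then show ?thesis by (rule summable_rabs_cancel)
qed

lemma entire_coeffs_shift:
  assumes "entire_coeffs a"
  shows "entire_coeffs (\<lambda>n. a (n + m))"
  unfolding entire_coeffs_def
proof
  fix z show "summable (\<lambda>n. a (n + m) * z ^ n)"
    using assms by (simp add: entire_coeffs_def summable_powser_ignore_initial_segment)
qed

lemma sums_powser: "entire_coeffs a \<Longrightarrow> (\<lambda>n. a n * z ^ n) sums powser a z"
  by (simp add: entire_coeffs_def powser_def summable_sums)

lemma sums_powser_cnj:
  assumes "entire_coeffs a"
  shows "(\<lambda>n. cnj (a n) * z ^ n) sums cnj (powser a (cnj z))"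
  using sums_powser[OF assms, of "cnj z"] by (subst (asm) sums_cnj[symmetric]) simp

lemma entire_coeffs_cnj: "entire_coeffs a \<Longrightarrow> entire_coeffs (\<lambda>n. cnj (a n))"
  by (auto simp: entire_coeffs_def[of "\<lambda>n. cnj (a n)"] intro: sums_summable sums_powser_cnj)

lemma powser_cnj: "entire_coeffs a \<Longrightarrow> cnj (powser a z) = powser (\<lambda>n. cnj (a n)) (cnj z)"
  using sums_powser_cnj[of a "cnj z"] by (simp add: powser_def sums_iff)

lemma powser_0 [simp]: "powser a 0 = a 0"
  by (simp add: powser_def)

lemma powser_split:
  assumes "entire_coeffs a"
  shows "powser a z = (\<Sum>k<m. a k * z ^ k) + z ^ m * powser (\<lambda>n. a (n + m)) z"
proof -
  have s: "summable (\<lambda>n. a n * z ^ n)" "summable (\<lambda>n. a (n + m) * z ^ n)"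
    using assms entire_coeffs_shift[OF assms] by (auto simp: entire_coeffs_def)
  have "powser a z = (\<Sum>n. a (n + m) * z ^ (n + m)) + (\<Sum>k<m. a k * z ^ k)"
    unfolding powser_def by (rule suminf_split_initial_segment[OF s(1)])
  also have "(\<Sum>n. a (n + m) * z ^ (n + m)) = (\<Sum>n. z ^ m * (a (n + m) * z ^ n))"
    by (simp add: power_add mult_ac)
  also have "\<dots> = z ^ m * powser (\<lambda>n. a (n + m)) z"
    unfolding powser_def by (rule suminf_mult[OF s(2)])
  finally show ?thesis by simp
qed

lemma powser_holomorphic:
  assumes "entire_coeffs a"
  shows "powser a holomorphic_on A"
proof -
  have "powser a holomorphic_on ball 0 R" for R
    by (rule power_series_holomorphic[where a = a])
      (use assms in \<open>simp add: entire_coeffs_def powser_def summable_sums\<close>)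
  then have "powser a analytic_on {z}" for z
    by (rule holomorphic_on_imp_analytic_at[of _ "ball 0 (cmod z + 1)"]) auto
  then show ?thesis
    by (meson analytic_imp_holomorphic analytic_on_analytic_at)
qed

lemma powser_continuous [continuous_intros]:
  assumes "entire_coeffs a" "continuous_on A h"
  shows "continuous_on A (\<lambda>x. powser a (h x))"
  by (rule continuous_on_compose2[OF holomorphic_on_imp_continuous_on[OF powser_holomorphic] assms(2)])
    (use assms in auto)

text \<open>One constant term is split off at a time. It is orthogonal to the rest, which is
  \<open>x\<close> times a holomorphic function, and the factor \<open>x\<close> has modulus 1 on
  the circle.\<close>

lemma parseval_remainder:
  assumes a: "entire_coeffs a"
  shows "circle_mean (\<lambda>x. (cmod (powser a x))\<^sup>2) =
    (\<Sum>k<m. (cmod (a k))\<^sup>2) + circle_mean (\<lambda>x. (cmod (powser (\<lambda>n. a (n + m)) x))\<^sup>2)"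
proof (induction m)
  case (Suc m)
  let ?b = "\<lambda>n. a (n + m)"
  let ?c = "\<lambda>n. a (n + Suc m)"
  have b: "entire_coeffs ?b" and c: "entire_coeffs ?c"
    using entire_coeffs_shift[OF a] by blast+
  have "circle_mean (\<lambda>x. (cmod (powser ?b x))\<^sup>2) = circle_mean (\<lambda>x. (cmod (x * powser ?c x + a m))\<^sup>2)"
    using powser_split[OF b, of _ 1] by (simp add: add.commute)
  also have "\<dots> = circle_mean (\<lambda>x. (cmod (x * powser ?c x))\<^sup>2) + circle_mean (\<lambda>x. (cmod (a m))\<^sup>2)"
  proof (rule circle_mean_norm_add)
    have "circle_mean (\<lambda>x. x * powser ?c x * cnj (a m)) = 0 * powser ?c 0 * cnj (a m)"
      by (rule circle_mean_holomorphic) (intro holomorphic_intros powser_holomorphic c)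
    then show "circle_mean (\<lambda>x. x * powser ?c x * cnj (a m)) = 0" by simp
  qed (intro continuous_intros c)+
  also have "circle_mean (\<lambda>x. (cmod (x * powser ?c x))\<^sup>2) = circle_mean (\<lambda>x. (cmod (powser ?c x))\<^sup>2)"
    by (rule circle_mean_cong) (simp add: norm_mult)
  finally show ?case using Suc by simp
qed simp

text \<open>The remainder after \<open>m\<close> terms is at most the square of the
  \<open>m\<close>-th tail of the absolutely convergent series of coefficients, so it tends to
  0.\<close>

lemma parseval_unit:
  assumes a: "entire_coeffs a"
  shows "(\<lambda>n. (cmod (a n))\<^sup>2) sums circle_mean (\<lambda>x. (cmod (powser a x))\<^sup>2)"
proof -
  define T where "T m = circle_mean (\<lambda>x. (cmod (powser (\<lambda>n. a (n + m)) x))\<^sup>2)" for m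
  define R where "R m = (\<Sum>n. cmod (a (n + m)))" for m
  have sa: "summable (\<lambda>n. cmod (a n))"
    using entire_coeffs_norm[OF a, of 1] by simp
  then have "R \<longlonglongrightarrow> 0"
    unfolding R_def by (rule suminf_exist_split2)
  then have R2: "(\<lambda>m. (R m)\<^sup>2) \<longlonglongrightarrow> 0"
    using tendsto_power[of R 0 sequentially 2] by simp
  have T: "0 \<le> T m" "T m \<le> (R m)\<^sup>2" for m
  proof -
    have e: "entire_coeffs (\<lambda>n. a (n + m))" by (rule entire_coeffs_shift[OF a])
    have le: "cmod (powser (\<lambda>n. a (n + m)) x) \<le> R m" if "cmod x = 1" for x
      unfolding powser_def R_def
      using that summable_ignore_initial_segment[OF sa, of m]
      by (intro order_trans[OF summable_norm]) (auto simp: norm_mult norm_power)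
    have "circle_mean (\<lambda>x. 0) \<le> T m"
      unfolding T_def by (intro circle_mean_mono continuous_intros e) auto
    then show "0 \<le> T m" by simp
    have "T m \<le> circle_mean (\<lambda>x. (R m)\<^sup>2)"
      unfolding T_def by (intro circle_mean_mono continuous_intros e power_mono le) auto
    then show "T m \<le> (R m)\<^sup>2" by simp
  qed
  have "T \<longlonglongrightarrow> 0"
    by (rule tendsto_sandwich[OF _ _ tendsto_const R2]) (use T in auto)
  then have "(\<lambda>m. T 0 - T m) \<longlonglongrightarrow> T 0 - 0"
    by (intro tendsto_intros)
  moreover have "T 0 - T m = (\<Sum>k<m. (cmod (a k))\<^sup>2)" for m
    using parseval_remainder[OF a, of m] by (simp add: T_def)
  ultimately show ?thesis
    by (simp add: sums_def T_def)
qed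

lemma entire_coeffs_scale: "entire_coeffs a \<Longrightarrow> entire_coeffs (\<lambda>n. a n * c ^ n)"
  by (auto simp: entire_coeffs_def mult.assoc simp flip: power_mult_distrib)

text \<open>Scaling the coefficients by powers of \<open>c\<close> carries the circle of radius
  \<open>cmod c\<close> to the unit circle.\<close>

lemma parseval:
  assumes a: "entire_coeffs a"
  shows "(\<lambda>n. (cmod (a n))\<^sup>2 * cmod c ^ (2 * n)) sums circle_mean (\<lambda>x. (cmod (powser a (c * x)))\<^sup>2)"
  using parseval_unit[OF entire_coeffs_scale[OF a, of c]]
  by (simp add: powser_def norm_mult norm_power power_mult_distrib mult.assoc
      mult.commute[of _ 2] flip: power_mult)

subsection \<open>The Fock norm in terms of Taylor coefficients\<close>

text \<open>The integral is invariant under each rotation; averaging over all rotations and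
  exchanging the two integrals puts the mean inside.\<close>

lemma nn_integral_polar_mean:
  fixes u :: "complex \<Rightarrow> real"
  assumes u: "continuous_on UNIV u" "\<And>z. 0 \<le> u z"
  shows "(\<integral>\<^sup>+z. ennreal (u z) \<partial>lborel) = (\<integral>\<^sup>+z. ennreal (circle_mean (\<lambda>x. u (z * x))) \<partial>lborel)"
proof -
  have [measurable]: "u \<in> borel_measurable borel"
    by (rule borel_measurable_continuous_onI[OF u(1)])
  have [measurable]: "cis \<in> borel_measurable borel"
    by (intro borel_measurable_continuous_onI continuous_intros)
  have "(\<integral>\<^sup>+z. ennreal (u z) \<partial>lborel) =
      (\<integral>\<^sup>+t. (\<integral>\<^sup>+z. ennreal (u z) \<partial>lborel) * indicator {0..1::real} t \<partial>lborel)"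
    by (subst nn_integral_cmult_indicator) auto
  also have "\<dots> = (\<integral>\<^sup>+t. (\<integral>\<^sup>+z. ennreal (u (cis (2 * pi * t) * z)) * indicator {0..1::real} t \<partial>lborel) \<partial>lborel)"
    by (intro nn_integral_cong)
      (subst nn_integral_multc, simp_all add: nn_integral_lborel_rotation[of "\<lambda>z. ennreal (u z)"])
  also have "\<dots> = (\<integral>\<^sup>+z. (\<integral>\<^sup>+t. ennreal (u (cis (2 * pi * t) * z)) * indicator {0..1::real} t \<partial>lborel) \<partial>lborel)"
    by (rule lborel_pair.Fubini') measurable
  also have "\<dots> = (\<integral>\<^sup>+z. ennreal (circle_mean (\<lambda>x. u (z * x))) \<partial>lborel)"
  proof (rule nn_integral_cong)
    fix z :: complex
    have "(\<lambda>t. u (z * cis (2 * pi * t))) integrable_on {0..1}"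
      by (intro integrable_continuous_real continuous_on_compose2[OF u(1)] continuous_intros) auto
    then show "(\<integral>\<^sup>+t. ennreal (u (cis (2 * pi * t) * z)) * indicator {0..1::real} t \<partial>lborel) =
        ennreal (circle_mean (\<lambda>x. u (z * x)))"
      unfolding circle_mean_def
      by (intro nn_integral_has_integral_lebesgue') (auto simp: mult.commute[of z] u)
  qed
  finally show ?thesis .
qed

text \<open>Averaging over circles and Parseval's identity leave a series of radial Gaussian
  moments. All terms are nonnegative, so sum and integral may be exchanged before any integrability
  is known.\<close>

lemma nn_integral_fock:
  assumes a: "entire_coeffs a"
  shows "(\<integral>\<^sup>+z. ennreal ((cmod (powser a z))\<^sup>2 * exp (- (cmod z)\<^sup>2)) \<partial>lborel) =
    (\<Sum>n. ennreal (pi * (fact n * (cmod (a n))\<^sup>2)))"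
proof -
  have "ennreal (circle_mean (\<lambda>x. (cmod (powser a (z * x)))\<^sup>2 * exp (- (cmod (z * x))\<^sup>2))) =
      (\<Sum>n. ennreal ((cmod (a n))\<^sup>2) * ennreal (cmod z ^ (2 * n) * exp (- (cmod z)\<^sup>2)))" for z
  proof -
    have "circle_mean (\<lambda>x. (cmod (powser a (z * x)))\<^sup>2 * exp (- (cmod (z * x))\<^sup>2)) =
        circle_mean (\<lambda>x. (cmod (powser a (z * x)))\<^sup>2 * exp (- (cmod z)\<^sup>2))"
      by (rule circle_mean_cong) (simp add: norm_mult)
    also have "\<dots> = circle_mean (\<lambda>x. (cmod (powser a (z * x)))\<^sup>2) * exp (- (cmod z)\<^sup>2)"
      by (simp add: circle_mean_def)
    finally have "(\<lambda>n. (cmod (a n))\<^sup>2 * (cmod z ^ (2 * n) * exp (- (cmod z)\<^sup>2))) sums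
        circle_mean (\<lambda>x. (cmod (powser a (z * x)))\<^sup>2 * exp (- (cmod (z * x))\<^sup>2))"
      using sums_mult2[OF parseval[OF a, of z], of "exp (- (cmod z)\<^sup>2)"] by (simp add: mult.assoc)
    from suminf_ennreal_eq[OF _ this] show ?thesis
      by (simp add: ennreal_mult')
  qed
  then have "(\<integral>\<^sup>+z. ennreal ((cmod (powser a z))\<^sup>2 * exp (- (cmod z)\<^sup>2)) \<partial>lborel) =
      (\<integral>\<^sup>+z. (\<Sum>n. ennreal ((cmod (a n))\<^sup>2) * ennreal (cmod z ^ (2 * n) * exp (- (cmod z)\<^sup>2))) \<partial>lborel)"
    by (subst nn_integral_polar_mean) (auto intro!: continuous_intros a)
  also have "\<dots> = (\<Sum>n. ennreal ((cmod (a n))\<^sup>2) *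
      (\<integral>\<^sup>+z. ennreal (cmod z ^ (2 * n) * exp (- (cmod z)\<^sup>2)) \<partial>lborel))"
    by (subst nn_integral_suminf) (auto simp: nn_integral_cmult)
  also have "\<dots> = (\<Sum>n. ennreal (pi * (fact n * (cmod (a n))\<^sup>2)))"
    unfolding nn_integral_gaussian_moment by (simp add: mult_ac flip: ennreal_mult')
  finally show ?thesis .
qed

lemma fock_norm_powser:
  assumes a: "entire_coeffs a" and "powser a \<in> fock_space"
  shows "(\<lambda>n. fact n * (cmod (a n))\<^sup>2) sums (fock_norm (powser a))\<^sup>2"
proof -
  have int: "integrable lborel (\<lambda>z. (cmod (powser a z))\<^sup>2 * exp (- (cmod z)\<^sup>2))"
    using assms by (simp add: fock_space_def)
  define I where "I = (LINT z|lborel. (cmod (powser a z))\<^sup>2 * exp (- (cmod z)\<^sup>2))"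
  have I: "0 \<le> I" "fock_norm (powser a) = sqrt (1 / pi * I)"
    by (auto simp: I_def fock_norm_def)
  have "(\<integral>\<^sup>+z. ennreal ((cmod (powser a z))\<^sup>2 * exp (- (cmod z)\<^sup>2)) \<partial>lborel) = ennreal I"
    using nn_integral_eq_integral[OF int] by (simp add: I_def)
  then have "(\<Sum>n. ennreal (pi * (fact n * (cmod (a n))\<^sup>2))) = ennreal I"
    by (rule trans[OF nn_integral_fock[OF a, symmetric]])
  then have "(\<lambda>n. ennreal (pi * (fact n * (cmod (a n))\<^sup>2))) sums ennreal I"
    using summable_sums[OF summableI, of "\<lambda>n. ennreal (pi * (fact n * (cmod (a n))\<^sup>2))"]
    by (simp only:)
  then have "(\<lambda>n. pi * (fact n * (cmod (a n))\<^sup>2)) sums I"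
    by (subst (asm) sums_ennreal) (use I(1) in auto)
  from sums_mult[OF this, of "1 / pi"] show ?thesis
    using I by simp
qed

lemma entire_powser:
  assumes "f holomorphic_on UNIV"
  obtains a where "entire_coeffs a" "f = powser a"
proof
  define a where "a n = (deriv ^^ n) f 0 / fact n" for n
  have s: "(\<lambda>n. a n * z ^ n) sums f z" for z
    using holomorphic_power_series[OF holomorphic_on_subset[OF assms], of 0 "cmod z + 1" z]
    by (simp add: a_def)
  then show "entire_coeffs a" "f = powser a"
    by (auto simp: entire_coeffs_def powser_def fun_eq_iff intro: sums_summable sums_unique)
qed

text \<open>Only the weights \<open>0! = 1! = 1\<close> occur, so exchanging the moduli of the two
  coefficients preserves the norm. This is what the second family in the equality case
  exploits.\<close>

lemma fock_norm_affine:
  assumes f: "\<And>z. f z = p + q * z" and "f \<in> fock_space"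
  shows "fock_norm f = sqrt ((cmod p)\<^sup>2 + (cmod q)\<^sup>2)"
proof -
  define a where "a n = (if n = 0 then p else if n = 1 then q else 0)" for n :: nat
  have a: "entire_coeffs a"
    unfolding entire_coeffs_def
    by (intro allI summable_finite[of "{0, 1}"]) (auto simp: a_def)
  have "powser a z = f z" for z
    unfolding powser_def
    by (subst suminf_finite[of "{0, 1}"]) (auto simp: a_def f)
  then have fa: "f = powser a" by auto
  have "(\<lambda>n. fact n * (cmod (a n))\<^sup>2) sums (\<Sum>n\<in>{0, 1}. fact n * (cmod (a n))\<^sup>2)"
    by (rule sums_finite) (auto simp: a_def)
  moreover have "(\<lambda>n. fact n * (cmod (a n))\<^sup>2) sums (fock_norm f)\<^sup>2"
    using fock_norm_powser[OF a] assms(2) fa by simp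
  ultimately have "(fock_norm f)\<^sup>2 = (cmod p)\<^sup>2 + (cmod q)\<^sup>2"
    using sums_unique2 by (fastforce simp: a_def)
  moreover have "0 \<le> fock_norm f"
    by (simp add: fock_norm_def)
  ultimately show ?thesis
    by (simp add: real_sqrt_unique)
qed

subsection \<open>The quotient outside the unit disc\<close>

text \<open>Since \<open>g\<close> is not identically 0, its zeros are isolated. The quotient is
  bounded by 1 around those outside the closed unit disc, so these singularities are
  removable.\<close>

lemma quotient_extension:
  assumes f: "f holomorphic_on UNIV" and g: "g holomorphic_on UNIV" and nz: "g \<beta> \<noteq> 0"
    and le: "\<And>z. cmod z > 1 \<Longrightarrow> cmod (f z) \<le> cmod (g z)"
  obtains Q where "Q holomorphic_on {z. cmod z > 1}"
    "\<And>z. cmod z > 1 \<Longrightarrow> cmod (Q z) \<le> 1" "\<And>z. cmod z > 1 \<Longrightarrow> f z = Q z * g z"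
proof -
  define q where "q z = f z / g z" for z
  have local: "remove_sings q analytic_on {z} \<and> cmod (remove_sings q z) \<le> 1 \<and> f z = remove_sings q z * g z"
    if z: "cmod z > 1" for z
  proof -
    obtain r where r: "r > 0" "\<And>w. w \<in> ball z r - {z} \<Longrightarrow> g w \<noteq> 0"
    proof (cases "g z = 0")
      case True
      then show ?thesis
        using isolated_zeros[OF g open_UNIV connected_UNIV _ _ _ nz, of z] that by auto
    next
      case False
      have "isCont g z"
        using holomorphic_on_imp_continuous_on[OF g] by (simp add: continuous_on_eq_continuous_at)
      then show ?thesis
        using continuous_at_avoid[of z g 0] False that by auto
    qed
    \<comment> \<open>This radius keeps the ball outside the closed unit disc and its punctured part
      free of zeros of \<open>g\<close>.\<close>
    define e where "e = min r (cmod z - 1)"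
    have e: "e > 0" using r z by (simp add: e_def)
    have out: "cmod w > 1" if "w \<in> ball z e" for w
      using that norm_triangle_sub[of z w] by (auto simp: e_def dist_norm)
    have g0: "g w \<noteq> 0" if "w \<in> ball z e - {z}" for w
      using that by (intro r(2)) (auto simp: e_def)
    have qhol: "q holomorphic_on ball z e - {z}"
      unfolding q_def using g0
      by (intro holomorphic_intros holomorphic_on_subset[OF f] holomorphic_on_subset[OF g]) auto
    \<comment> \<open>Division by 0 yields 0, so the bound holds at a zero of \<open>g\<close> as
      well.\<close>
    have q1: "cmod (q w) \<le> 1" if "w \<in> ball z e" for w
      using le[OF out[OF that]] by (cases "g w = 0") (auto simp: q_def norm_divide)
    have ev: "\<forall>\<^sub>F w in at z. w \<in> ball z e - {z}"
      using e by (intro eventually_at_in_open) auto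
    have "\<forall>\<^sub>F w in at z. cmod (q w) \<le> 1"
      using ev by eventually_elim (use q1 in auto)
    then obtain h where h: "h holomorphic_on ball z e" "\<And>w. w \<in> ball z e - {z} \<Longrightarrow> h w = q w"
      using holomorphic_on_extend_bounded[OF qhol] e by auto
    have "h \<midarrow>z\<rightarrow> h z"
      using h(1) e by (meson centre_in_ball continuous_on_eq_continuous_at holomorphic_on_imp_continuous_on
          isCont_def open_ball)
    moreover have "\<forall>\<^sub>F w in at z. h w = q w"
      using ev by eventually_elim (use h in auto)
    ultimately have lim: "q \<midarrow>z\<rightarrow> h z"
      by (rule Lim_transform_eventually)
    have Q: "remove_sings q z = h z"
      using lim by (rule remove_sings_eqI)
    have "isolated_singularity_at q z"
      unfolding isolated_singularity_at_def using qhol e by (auto simp: analytic_on_open open_delete intro!: exI[of _ e])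
    then have "remove_sings q analytic_on {z}"
      using lim by (rule remove_sings_analytic_at)
    moreover have "cmod (h z) \<le> 1"
      by (rule tendsto_upperbound[OF tendsto_norm[OF lim]]) (use ev in \<open>auto elim!: eventually_mono simp: q1\<close>)
    moreover have "f z = h z * g z"
    proof (rule tendsto_unique)
      show "f \<midarrow>z\<rightarrow> f z"
        using f by (metis UNIV_I continuous_on_eq_continuous_at holomorphic_on_imp_continuous_on isCont_def open_UNIV)
      have "g \<midarrow>z\<rightarrow> g z"
        using g by (metis UNIV_I continuous_on_eq_continuous_at holomorphic_on_imp_continuous_on isCont_def open_UNIV)
      then have "(\<lambda>w. q w * g w) \<midarrow>z\<rightarrow> h z * g z"
        by (intro tendsto_mult lim)
      moreover have "\<forall>\<^sub>F w in at z. q w * g w = f w"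
        using ev by eventually_elim (use g0 in \<open>auto simp: q_def\<close>)
      ultimately show "f \<midarrow>z\<rightarrow> h z * g z"
        by (rule Lim_transform_eventually)
    qed auto
    ultimately show ?thesis by (simp add: Q)
  qed
  have "remove_sings q holomorphic_on {z. cmod z > 1}"
    using local by (intro analytic_imp_holomorphic) (subst analytic_on_analytic_at, auto)
  then show ?thesis
    using local by (intro that[of "remove_sings q"]) auto
qed

text \<open>Inversion turns the exterior of the disc into a punctured disc; boundedness makes the
  puncture, which is the point at infinity, removable.\<close>

lemma quotient_at_infinity:
  assumes f: "f holomorphic_on UNIV" and g: "g holomorphic_on UNIV" and nz: "g \<beta> \<noteq> 0"
    and le: "\<And>z. cmod z > 1 \<Longrightarrow> cmod (f z) \<le> cmod (g z)"
  obtains S where "S holomorphic_on ball 0 1" "\<And>w. w \<in> ball 0 1 \<Longrightarrow> cmod (S w) \<le> 1"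
    "\<And>w. w \<in> ball 0 1 - {0} \<Longrightarrow> f (1 / w) = S w * g (1 / w)"
proof -
  obtain Q where Q: "Q holomorphic_on {z. cmod z > 1}"
    "\<And>z. cmod z > 1 \<Longrightarrow> cmod (Q z) \<le> 1" "\<And>z. cmod z > 1 \<Longrightarrow> f z = Q z * g z"
    using quotient_extension[OF assms] by metis
  have out: "cmod (1 / w) > 1" if "w \<in> ball 0 1 - {0}" for w
    using that by (auto simp: norm_divide)
  have "(Q \<circ> (\<lambda>w. 1 / w)) holomorphic_on ball 0 1 - {0}"
    by (rule holomorphic_on_compose_gen[OF _ Q(1)]) (use out in \<open>auto intro!: holomorphic_intros\<close>)
  moreover have ev: "\<forall>\<^sub>F w in at 0. w \<in> ball 0 1 - {0::complex}"
    by (intro eventually_at_in_open) auto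
  then have "\<forall>\<^sub>F w in at 0. cmod ((Q \<circ> (\<lambda>w. 1 / w)) w) \<le> 1"
    by eventually_elim (use Q(2) out in auto)
  ultimately obtain S where S: "S holomorphic_on ball 0 1"
      "\<And>w. w \<in> ball 0 1 - {0} \<Longrightarrow> S w = Q (1 / w)"
    using holomorphic_on_extend_bounded[of "Q \<circ> (\<lambda>w. 1 / w)" "ball 0 1" 0] by auto
  have "S \<midarrow>0\<rightarrow> S 0"
    using S(1) by (meson centre_in_ball continuous_on_eq_continuous_at holomorphic_on_imp_continuous_on
        isCont_def open_ball zero_less_one)
  then have "cmod (S 0) \<le> 1"
    by (rule tendsto_upperbound[OF tendsto_norm])
      (use ev in \<open>auto elim!: eventually_mono simp: S Q(2)[OF out]\<close>)
  then have "cmod (S w) \<le> 1" if "w \<in> ball 0 1" for w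
    using that S(2)[of w] Q(2)[OF out, of w] by (cases "w = 0") auto
  with S Q(3) out show ?thesis by (intro that[of S]) auto
qed

section \<open>Pairs of entire power series with bounded quotient\<close>

lemma inverse_cnj_unimodular: "cmod x = 1 \<Longrightarrow> inverse (cnj x) = x"
  using complex_norm_square[of x] by (intro inverse_unique) (simp add: mult.commute)

text \<open>\<open>S\<close> is the quotient of the two functions in the variable
  \<open>w = 1 / z\<close>. The relation \<open>ab\<close> leaves out \<open>w = 0\<close>, where
  \<open>1 / w\<close> would be 0 instead of infinity.\<close>

locale dominated_pair =
  fixes a b :: "nat \<Rightarrow> complex" and S :: "complex \<Rightarrow> complex"
  assumes a: "entire_coeffs a" and b: "entire_coeffs b"
    and S: "S holomorphic_on ball 0 1" and S1: "\<And>w. w \<in> ball 0 1 \<Longrightarrow> cmod (S w) \<le> 1"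
    and ab: "\<And>w. w \<in> ball 0 1 - {0} \<Longrightarrow> powser a (1 / w) = S w * powser b (1 / w)"
begin

definition p :: "nat \<Rightarrow> real" where "p n = (cmod (b n))\<^sup>2 - (cmod (a n))\<^sup>2"

text \<open>With \<open>w = 1 / z\<close>, the tails of the two power series satisfy \<open>f\<^sub>m = S g\<^sub>m + E\<close>, where \<open>E\<close>
  is holomorphic in \<open>w\<close> and vanishes at \<open>w = 0\<close>, while the conjugate of \<open>f\<^sub>m\<close> is on the circle
  also holomorphic in \<open>w\<close>; hence \<open>E\<close> is orthogonal to \<open>f\<^sub>m\<close>.\<close>

lemma tail_defect:
  assumes r: "r > 1"
  shows "\<exists>E. continuous_on (sphere 0 1) E \<and>
    (\<forall>x. cmod x = 1 \<longrightarrow> powser (\<lambda>n. a (n + m)) (of_real r * x) =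
      S (cnj x / of_real r) * powser (\<lambda>n. b (n + m)) (of_real r * x) + E x) \<and>
    circle_mean (\<lambda>x. (cmod (S (cnj x / of_real r) * powser (\<lambda>n. b (n + m)) (of_real r * x)))\<^sup>2) =
      circle_mean (\<lambda>x. (cmod (powser (\<lambda>n. a (n + m)) (of_real r * x)))\<^sup>2) +
      circle_mean (\<lambda>x. (cmod (E x))\<^sup>2)"
proof -
  let ?a = "\<lambda>n. a (n + m)" and ?b = "\<lambda>n. b (n + m)"
  have a': "entire_coeffs ?a" and b': "entire_coeffs ?b"
    by (intro entire_coeffs_shift a b)+
  \<comment> \<open>After multiplication of \<open>ab\<close> by \<open>w ^ m\<close>, the terms of
    degree below \<open>m\<close> carry positive powers of \<open>w\<close>. \<open>F\<close>
    collects them, hence vanishes at 0.\<close>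
  define F where "F w = S w * (\<Sum>k<m. b k * w ^ (m - k)) - (\<Sum>k<m. a k * w ^ (m - k))" for w
  have F0: "F 0 = 0"
    by (simp add: F_def power_0_left)
  have Fhol: "F holomorphic_on ball 0 1"
    unfolding F_def by (intro holomorphic_intros S)
  \<comment> \<open>The argument is the reciprocal of \<open>r * x\<close> on the circle. The sign
    makes \<open>S\<close> times the tail of \<open>b\<close> the sum of \<open>E\<close> and the
    tail of \<open>a\<close>, as Pythagoras requires; the final witness is
    \<open>- E\<close>.\<close>
  define E where "E x = - F (cnj x / of_real r)" for x
  have in_ball: "cnj x / of_real r \<in> ball 0 1 - {0}" if "cmod x = 1" for x
    using that r by (auto simp: norm_divide)
  have Scont: "continuous_on (sphere 0 1) (\<lambda>x. S (cnj x / of_real r))"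
    by (rule continuous_on_compose2[OF holomorphic_on_imp_continuous_on[OF S]])
      (use in_ball in \<open>auto intro!: continuous_intros\<close>)
  have "continuous_on (sphere 0 1) (\<lambda>x. F (cnj x / of_real r))"
    by (rule continuous_on_compose2[OF holomorphic_on_imp_continuous_on[OF Fhol]])
      (use in_ball in \<open>auto intro!: continuous_intros\<close>)
  then have Econt: "continuous_on (sphere 0 1) E"
    unfolding E_def by (intro continuous_intros)
  have pw: "w ^ m * (1 / w) ^ k = w ^ (m - k)" if "w \<noteq> 0" "k \<le> m" for w :: complex and k
    using that by (simp add: power_diff power_inverse divide_inverse)
  have tail: "powser ?a (1 / w) = S w * powser ?b (1 / w) + F w" if w: "w \<in> ball 0 1 - {0}" for w
  proof -
    have w0: "w \<noteq> 0" using w by auto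
    have split: "w ^ m * powser c (1 / w) = (\<Sum>k<m. c k * w ^ (m - k)) + powser (\<lambda>n. c (n + m)) (1 / w)"
      if "entire_coeffs c" for c
    proof -
      have "w ^ m * powser c (1 / w) = (\<Sum>k<m. c k * (w ^ m * (1 / w) ^ k)) +
          w ^ m * (1 / w) ^ m * powser (\<lambda>n. c (n + m)) (1 / w)"
        unfolding powser_split[OF that, of "1 / w" m]
        by (simp add: algebra_simps sum_distrib_left del: power_divide power_one_over)
      then show ?thesis
        using w0 by (simp add: pw del: power_divide power_one_over)
    qed
    have "w ^ m * powser a (1 / w) = S w * (w ^ m * powser b (1 / w))"
      by (simp add: ab[OF w])
    then show ?thesis
      unfolding split[OF a] split[OF b] F_def by (simp add: algebra_simps)
  qed
  have recip: "1 / (cnj x / of_real r) = of_real r * x" if "cmod x = 1" for x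
    using inverse_cnj_unimodular[OF that] by (simp add: divide_inverse)
  have rel: "powser ?a (of_real r * x) = S (cnj x / of_real r) * powser ?b (of_real r * x) - E x"
    if "cmod x = 1" for x
    using tail[OF in_ball[OF that]] recip[OF that] by (simp add: E_def)
  let ?U = "\<lambda>x. S (cnj x / of_real r) * powser ?b (of_real r * x)"
  have "circle_mean (\<lambda>x. (cmod (?U x))\<^sup>2) =
      circle_mean (\<lambda>x. (cmod (E x + powser ?a (of_real r * x)))\<^sup>2)"
    by (rule circle_mean_cong) (simp add: rel)
  also have "\<dots> = circle_mean (\<lambda>x. (cmod (E x))\<^sup>2) +
      circle_mean (\<lambda>x. (cmod (powser ?a (of_real r * x)))\<^sup>2)"
  proof (rule circle_mean_norm_add)
    \<comment> \<open>At \<open>cnj x\<close> this is the product of \<open>E x\<close> with the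
      conjugated tail. It is holomorphic on the disc of radius \<open>r > 1\<close> and vanishes at
      0.\<close>
    let ?h = "\<lambda>w. - F (w / of_real r) * powser (\<lambda>n. cnj (?a n)) (of_real r * w)"
    have "(F \<circ> (\<lambda>w. w / of_real r)) holomorphic_on ball 0 r"
      by (rule holomorphic_on_compose_gen[OF _ Fhol])
        (use r in \<open>auto intro!: holomorphic_intros simp: norm_divide\<close>)
    moreover have "(powser (\<lambda>n. cnj (?a n)) \<circ> (\<lambda>w. of_real r * w)) holomorphic_on ball 0 r"
      by (intro holomorphic_on_compose_gen[OF _ powser_holomorphic[of _ UNIV]] holomorphic_intros
          entire_coeffs_cnj a') auto
    ultimately have "?h holomorphic_on ball 0 r"
      by (simp add: o_def holomorphic_intros)
    from circle_mean_holomorphic_cnj[OF this r]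
    have "circle_mean (\<lambda>x. ?h (cnj x)) = 0" by (simp add: F0)
    then show "circle_mean (\<lambda>x. E x * cnj (powser ?a (of_real r * x))) = 0"
      by (simp add: E_def powser_cnj[OF a'])
  qed (intro continuous_intros a' Econt)+
  finally show ?thesis
    by (intro exI[of _ "\<lambda>x. - E x"] conjI continuous_intros Econt) (simp_all add: rel)
qed

end

subsection \<open>Tail sums\<close>

lemma circle_mean_nonneg:
  fixes u :: "complex \<Rightarrow> real"
  assumes "continuous_on (sphere 0 1) u" "\<And>x. cmod x = 1 \<Longrightarrow> 0 \<le> u x"
  shows "0 \<le> circle_mean u"
  using circle_mean_mono[of "\<lambda>x. 0" u] assms by simp

text \<open>Parseval's identity on the circle of radius \<open>sqrt \<bar>s\<bar>\<close> gives
  absolute convergence of both series.\<close>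

lemma summable_square_norm_diff:
  assumes a: "entire_coeffs a" and b: "entire_coeffs b"
  shows "summable (\<lambda>n. ((cmod (b n))\<^sup>2 - (cmod (a n))\<^sup>2) * s ^ n)"
proof -
  have "summable (\<lambda>n. (cmod (c n))\<^sup>2 * s ^ n)" if "entire_coeffs c" for c
  proof (rule summable_norm_cancel)
    have "(\<lambda>n. (cmod (c n))\<^sup>2 * cmod (of_real (sqrt \<bar>s\<bar>)) ^ (2 * n)) sums
        circle_mean (\<lambda>x. (cmod (powser c (of_real (sqrt \<bar>s\<bar>) * x)))\<^sup>2)"
      by (rule parseval[OF that])
    then show "summable (\<lambda>n. norm ((cmod (c n))\<^sup>2 * s ^ n))"
      by (simp add: sums_iff power_mult abs_mult power_abs)
  qed
  from summable_diff[OF this[OF b] this[OF a]] show ?thesis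
    by (simp add: left_diff_distrib)
qed

text \<open>Abel summation. The weight is \<open>m! - (m - 1)!\<close> for positive \<open>m\<close>
  and 1 for \<open>m = 0\<close>. The boundary term is at most a tail of the absolutely convergent
  series, because \<open>(N - 1)! \<le> (n + N)!\<close>.\<close>

lemma sum_fact_by_parts:
  fixes p :: "nat \<Rightarrow> real"
  assumes p: "summable p" and abs: "summable (\<lambda>n. fact n * \<bar>p n\<bar>)"
  shows "(\<lambda>m. (fact m - (case m of 0 \<Rightarrow> 0 | Suc n \<Rightarrow> fact n)) * (\<Sum>n. p (n + m))) sums (\<Sum>n. fact n * p n)"
proof -
  define T where "T m = (\<Sum>n. p (n + m))" for m
  define v :: "nat \<Rightarrow> real" where "v m = (case m of 0 \<Rightarrow> 0 | Suc n \<Rightarrow> fact n)" for m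
  have v: "0 \<le> v m" "v m \<le> fact m" "v (Suc m) = fact m" for m
    by (auto simp: v_def fact_mono split: nat.split)
  have T: "T m = p m + T (Suc m)" for m
    using suminf_split_head[OF summable_ignore_initial_segment[OF p, of m]] by (simp add: T_def)
  have part: "(\<Sum>m<N. (fact m - v m) * T m) = (\<Sum>n<N. fact n * p n) + v N * T N" for N
  proof (induction N)
    case (Suc N)
    then show ?case using T[of N] by (simp add: v(3) algebra_simps)
  qed (simp add: v_def)
  have sabs: "summable (\<lambda>n. fact (n + N) * \<bar>p (n + N)\<bar>)" for N
    using summable_ignore_initial_segment[OF abs, of N] .
  have bound: "\<bar>v N * T N\<bar> \<le> (\<Sum>n. fact (n + N) * \<bar>p (n + N)\<bar>)" for N
  proof -
    have le: "v N * \<bar>p (n + N)\<bar> \<le> fact (n + N) * \<bar>p (n + N)\<bar>" for n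
      by (intro mult_right_mono order_trans[OF v(2)] fact_mono) auto
    have s: "summable (\<lambda>n. \<bar>v N * p (n + N)\<bar>)"
      by (rule summable_comparison_test'[OF sabs[of N], of 0]) (use le v(1) in \<open>simp add: abs_mult\<close>)
    have "v N * T N = (\<Sum>n. v N * p (n + N))"
      unfolding T_def by (rule suminf_mult[symmetric]) (rule summable_ignore_initial_segment[OF p])
    also have "\<bar>\<dots>\<bar> \<le> (\<Sum>n. \<bar>v N * p (n + N)\<bar>)"
      by (rule summable_rabs[OF s])
    also have "\<dots> \<le> (\<Sum>n. fact (n + N) * \<bar>p (n + N)\<bar>)"
      by (rule suminf_le[OF _ s sabs]) (use le v(1) in \<open>simp add: abs_mult\<close>)
    finally show ?thesis .
  qed
  have "(\<lambda>N. v N * T N) \<longlonglongrightarrow> 0"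
    by (rule Lim_null_comparison[OF _ suminf_exist_split2[OF abs]]) (use bound in auto)
  moreover have "(\<lambda>N. \<Sum>n<N. fact n * p n) \<longlonglongrightarrow> (\<Sum>n. fact n * p n)"
    by (rule summable_LIMSEQ, rule summable_rabs_cancel) (use abs in \<open>simp add: abs_mult\<close>)
  ultimately have "(\<lambda>N. (\<Sum>n<N. fact n * p n) + v N * T N) \<longlonglongrightarrow> (\<Sum>n. fact n * p n) + 0"
    by (rule tendsto_add[rotated])
  then show ?thesis
    unfolding sums_def part[symmetric] by (simp add: v_def T_def)
qed

context dominated_pair
begin

lemma summable_p: "summable (\<lambda>n. p n * s ^ n)"
  unfolding p_def by (rule summable_square_norm_diff[OF a b])

text \<open>As \<open>S\<close> is bounded by 1, the mean square of the tail of \<open>b\<close>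
  exceeds that of the tail of \<open>a\<close> by at least the mean square of \<open>E\<close>;
  Parseval's identity expresses the excess by \<open>p\<close>. Keeping \<open>E\<close> allows
  equality to be analysed.\<close>

lemma tail_sum_ge_defect:
  assumes r: "r > 1"
  shows "\<exists>E. continuous_on (sphere 0 1) E \<and>
    (\<forall>x. cmod x = 1 \<longrightarrow> powser (\<lambda>n. a (n + m)) (of_real r * x) =
      S (cnj x / of_real r) * powser (\<lambda>n. b (n + m)) (of_real r * x) + E x) \<and>
    circle_mean (\<lambda>x. (cmod (E x))\<^sup>2) \<le> (\<Sum>n. p (n + m) * (r\<^sup>2) ^ n)"
proof -
  let ?a = "\<lambda>n. a (n + m)" and ?b = "\<lambda>n. b (n + m)"
  have a': "entire_coeffs ?a" and b': "entire_coeffs ?b"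
    by (intro entire_coeffs_shift a b)+
  obtain E where E: "continuous_on (sphere 0 1) E"
    "\<forall>x. cmod x = 1 \<longrightarrow> powser ?a (of_real r * x) = S (cnj x / of_real r) * powser ?b (of_real r * x) + E x"
    "circle_mean (\<lambda>x. (cmod (S (cnj x / of_real r) * powser ?b (of_real r * x)))\<^sup>2) =
      circle_mean (\<lambda>x. (cmod (powser ?a (of_real r * x)))\<^sup>2) + circle_mean (\<lambda>x. (cmod (E x))\<^sup>2)"
    using tail_defect[OF r, of m] by (elim exE conjE)
  have in_ball: "cnj x / of_real r \<in> ball 0 1" if "cmod x = 1" for x
    using that r by (auto simp: norm_divide)
  have "continuous_on (sphere 0 1) (\<lambda>x. S (cnj x / of_real r))"
    by (rule continuous_on_compose2[OF holomorphic_on_imp_continuous_on[OF S]])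
      (use in_ball r in \<open>auto intro!: continuous_intros\<close>)
  then have "circle_mean (\<lambda>x. (cmod (S (cnj x / of_real r) * powser ?b (of_real r * x)))\<^sup>2) \<le>
      circle_mean (\<lambda>x. (cmod (powser ?b (of_real r * x)))\<^sup>2)"
    using S1[OF in_ball] b'
    by (intro circle_mean_mono continuous_intros)
      (auto simp: norm_mult intro!: power_mono mult_left_le_one_le)
  moreover have "(\<lambda>n. p (n + m) * (r\<^sup>2) ^ n) sums (circle_mean (\<lambda>x. (cmod (powser ?b (of_real r * x)))\<^sup>2) -
      circle_mean (\<lambda>x. (cmod (powser ?a (of_real r * x)))\<^sup>2))"
    using sums_diff[OF parseval[OF b', of "of_real r"] parseval[OF a', of "of_real r"]] r
    by (simp add: p_def left_diff_distrib power_mult)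
  ultimately have "circle_mean (\<lambda>x. (cmod (E x))\<^sup>2) \<le> (\<Sum>n. p (n + m) * (r\<^sup>2) ^ n)"
    using E(3) by (simp add: sums_iff)
  with E(1,2) show ?thesis by (intro exI[of _ E] conjI)
qed

text \<open>The previous bound requires a radius above 1, where \<open>S\<close> is evaluated inside
  the disc. Continuity of the power series in the squared radius \<open>s\<close> allows
  \<open>s\<close> to decrease to 1.\<close>

lemma tail_sum_nonneg: "0 \<le> (\<Sum>n. p (n + m))"
proof -
  let ?T = "\<lambda>s::real. \<Sum>n. p (n + m) * s ^ n"
  have ge: "0 \<le> ?T s" if "s > 1" for s
  proof -
    have s: "sqrt s > 1" "(sqrt s)\<^sup>2 = s" using that by auto
    obtain E where E: "continuous_on (sphere 0 1) E"
        "circle_mean (\<lambda>x. (cmod (E x))\<^sup>2) \<le> (\<Sum>n. p (n + m) * ((sqrt s)\<^sup>2) ^ n)"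
      using tail_sum_ge_defect[OF s(1), of m] by (elim exE conjE)
    have "0 \<le> circle_mean (\<lambda>x. (cmod (E x))\<^sup>2)"
      by (intro circle_mean_nonneg continuous_intros E) auto
    with E(2) show ?thesis by (simp only: s(2))
  qed
  have "isCont ?T 1"
    by (rule isCont_powser_converges_everywhere)
      (simp add: summable_powser_ignore_initial_segment summable_p)
  then have "(?T \<longlongrightarrow> ?T 1) (at_right 1)"
    by (simp add: isCont_def filterlim_at_split)
  then have "0 \<le> ?T 1"
    by (rule tendsto_lowerbound) (auto simp: eventually_at_filter ge)
  then show ?thesis by simp
qed

lemma sum_fact_by_tails:
  assumes fa: "summable (\<lambda>n. fact n * (cmod (a n))\<^sup>2)" and fb: "summable (\<lambda>n. fact n * (cmod (b n))\<^sup>2)"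
  shows "(\<lambda>m. (fact m - (case m of 0 \<Rightarrow> 0 | Suc n \<Rightarrow> fact n)) * (\<Sum>n. p (n + m))) sums (\<Sum>n. fact n * p n)"
proof (rule sum_fact_by_parts)
  show "summable p" using summable_p[of 1] by simp
  show "summable (\<lambda>n. fact n * \<bar>p n\<bar>)"
    by (rule summable_comparison_test'[OF summable_add[OF fa fb], of 0])
      (use abs_triangle_ineq4[of "(cmod (b _))\<^sup>2" "(cmod (a _))\<^sup>2"] in
        \<open>auto simp: abs_mult p_def add.commute intro!: mult_left_mono simp flip: distrib_left\<close>)
qed

text \<open>Tails from degree 2 on have no defect, so each is \<open>S\<close> times its
  counterpart. Comparing the tails from \<open>m\<close> and from \<open>m + 1\<close> shows that
  \<open>S\<close> equals \<open>a m / b m\<close> on a circle, and this constant passes to all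
  coefficients.\<close>

lemma proportional:
  assumes p0: "\<And>n. n \<ge> 2 \<Longrightarrow> p n = 0" and m: "m \<ge> 2" "b m \<noteq> 0"
  shows "cmod (a m / b m) = 1 \<and> a n = a m / b m * b n"
proof
  \<comment> \<open>At the convenient radius 2 the mean square of the defect is bounded by 0, so the
    defect vanishes on the circle.\<close>
  have defect_0: "powser (\<lambda>n. a (n + k)) (2 * x) = S (cnj x / 2) * powser (\<lambda>n. b (n + k)) (2 * x)"
    if k: "k \<ge> 2" and x: "cmod x = 1" for k x
  proof -
    have z: "p (n + k) = 0" for n using p0 k by simp
    have two: "(2::real) > 1" by simp
    obtain E where E: "continuous_on (sphere 0 1) E"
      "\<forall>x. cmod x = 1 \<longrightarrow> powser (\<lambda>n. a (n + k)) (of_real 2 * x) =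
        S (cnj x / of_real 2) * powser (\<lambda>n. b (n + k)) (of_real 2 * x) + E x"
      "circle_mean (\<lambda>x. (cmod (E x))\<^sup>2) \<le> (\<Sum>n. p (n + k) * (2\<^sup>2) ^ n)"
      using tail_sum_ge_defect[OF two, of k] by (elim exE conjE)
    have "0 \<le> circle_mean (\<lambda>x. (cmod (E x))\<^sup>2)"
      by (intro circle_mean_nonneg continuous_intros E) auto
    with E(3) have "circle_mean (\<lambda>x. (cmod (E x))\<^sup>2) = 0" by (simp add: z)
    then have "(cmod (E x))\<^sup>2 = 0"
      by (intro circle_mean_eq_0D[of "\<lambda>x. (cmod (E x))\<^sup>2"] continuous_intros E x) auto
    with E(2) x show ?thesis by simp
  qed
  have split: "powser (\<lambda>n. c (n + m)) z = c m + z * powser (\<lambda>n. c (n + Suc m)) z"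
    if "entire_coeffs c" for c z
    using powser_split[OF entire_coeffs_shift[OF that, of m], of z 1] by simp
  define \<kappa> where "\<kappa> = a m / b m"
  have S\<kappa>: "S (cnj x / 2) = \<kappa>" if x: "cmod x = 1" for x
  proof -
    define A B where "A = powser (\<lambda>n. a (n + Suc m)) (2 * x)" and "B = powser (\<lambda>n. b (n + Suc m)) (2 * x)"
    have "A = S (cnj x / 2) * B"
      unfolding A_def B_def by (rule defect_0) (use m x in auto)
    moreover have "a m + 2 * x * A = S (cnj x / 2) * (b m + 2 * x * B)"
      using defect_0[OF m(1) x] unfolding split[OF a] split[OF b] A_def B_def .
    ultimately have "a m = S (cnj x / 2) * b m"
      by (simp add: algebra_simps)
    then show ?thesis using m(2) by (simp add: \<kappa>_def)
  qed
  have eq: "powser a (2 * x) = \<kappa> * powser b (2 * x)" if x: "cmod x = 1" for x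
  proof -
    have "powser a (1 / (cnj x / 2)) = S (cnj x / 2) * powser b (1 / (cnj x / 2))"
      by (rule ab) (use x in \<open>auto simp: norm_divide\<close>)
    moreover have "1 / (cnj x / 2) = 2 * inverse (cnj x)"
      by (simp add: inverse_eq_divide)
    then have "1 / (cnj x / 2) = 2 * x"
      by (simp only: inverse_cnj_unimodular[OF x])
    ultimately show ?thesis by (simp only: S\<kappa>[OF x])
  qed
  define d where "d n = a n - \<kappa> * b n" for n
  have d: "(\<lambda>n. d n * z ^ n) sums (powser a z - \<kappa> * powser b z)" for z
    using sums_diff[OF sums_powser[OF a] sums_mult[OF sums_powser[OF b], of \<kappa>], of z z]
    by (simp add: d_def algebra_simps)
  then have ed: "entire_coeffs d" and pd: "powser d z = powser a z - \<kappa> * powser b z" for z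
    by (auto simp: entire_coeffs_def powser_def intro: sums_summable sums_unique[symmetric])
  \<comment> \<open>Parseval's identity acts as an identity theorem: vanishing on one circle kills
    every coefficient.\<close>
  have "circle_mean (\<lambda>x. (cmod (powser d (2 * x)))\<^sup>2) = circle_mean (\<lambda>x. 0)"
    by (rule circle_mean_cong) (simp add: pd eq)
  then have "(\<lambda>n. (cmod (d n))\<^sup>2 * cmod 2 ^ (2 * n)) sums 0"
    using parseval[OF ed, of 2] by simp
  then have "d n = 0"
    using suminf_eq_zero_iff[of "\<lambda>n. (cmod (d n))\<^sup>2 * cmod 2 ^ (2 * n)"] by (simp add: sums_iff)
  then show "a n = a m / b m * b n" by (simp add: d_def \<kappa>_def)
  have "(cmod (b m))\<^sup>2 = (cmod (a m))\<^sup>2" using p0[OF m(1)] by (simp add: p_def)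
  then have "cmod (b m) = cmod (a m)" by (metis norm_ge_zero power2_eq_imp_eq)
  then show "cmod (a m / b m) = 1" using m by (auto simp: norm_divide)
qed

end

text \<open>On the unit circle equal norms leave only the cross terms to compare, and domination
  forces these to agree. The pairs of squared moduli then have equal sums and equal products, so
  they coincide up to order; the two orders give the two alternatives.\<close>

lemma affine_pair:
  fixes a0 a1 b0 b1 :: complex
  assumes le: "\<And>z. cmod z > 1 \<Longrightarrow> cmod (a0 + a1 * z) \<le> cmod (b0 + b1 * z)"
    and eq: "(cmod a0)\<^sup>2 + (cmod a1)\<^sup>2 = (cmod b0)\<^sup>2 + (cmod b1)\<^sup>2"
    and a1: "cmod a1 \<le> cmod b1"
  shows "(\<exists>\<eta>. cmod \<eta> = 1 \<and> a0 = \<eta> * b0 \<and> a1 = \<eta> * b1) \<or>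
    (\<exists>\<eta> a. cmod \<eta> = 1 \<and> cmod a < 1 \<and> a0 = b1 * \<eta> \<and> a1 = b1 * a \<and> b0 = b1 * (cnj a * \<eta>))"
proof -
  have le1: "cmod (a0 + a1 * z) \<le> cmod (b0 + b1 * z)" if z: "cmod z = 1" for z
  \<comment> \<open>The hypothesis holds only outside the closed disc, so the circle is approached
    radially from outside.\<close>
  proof (rule tendsto_le[of "at_right (1::real)"])
    show "((\<lambda>t. cmod (a0 + a1 * (of_real t * z))) \<longlongrightarrow> cmod (a0 + a1 * z)) (at_right 1)"
      "((\<lambda>t. cmod (b0 + b1 * (of_real t * z))) \<longlongrightarrow> cmod (b0 + b1 * z)) (at_right 1)"
      by (auto intro!: tendsto_eq_intros)
    show "\<forall>\<^sub>F t in at_right 1. cmod (a0 + a1 * (of_real t * z)) \<le> cmod (b0 + b1 * (of_real t * z))"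
      by (auto simp: eventually_at_filter norm_mult z intro!: always_eventually le)
  qed auto
  define d where "d = b1 * cnj b0 - a1 * cnj a0"
  have "0 \<le> Re (d * z)" if z: "cmod z = 1" for z
  proof -
    have "(cmod (u + v * z))\<^sup>2 = (cmod u)\<^sup>2 + (cmod v)\<^sup>2 + 2 * Re (v * cnj u * z)" for u v
    proof -
      have "(Re z)\<^sup>2 + (Im z)\<^sup>2 = 1" using z by (simp add: cmod_def)
      then show ?thesis
        by (simp add: cmod_power2, algebra)
    qed
    moreover have "(cmod (a0 + a1 * z))\<^sup>2 \<le> (cmod (b0 + b1 * z))\<^sup>2"
      by (intro power_mono le1 z) auto
    ultimately show ?thesis
      using eq by (simp add: d_def left_diff_distrib)
  qed
  \<comment> \<open>For nonzero \<open>d\<close> this unimodular number gives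
    \<open>d * z = - cmod d\<close>, which is negative.\<close>
  from this[of "- (cnj d / of_real (cmod d))"] have "d = 0"
    by (cases "d = 0") (auto simp: norm_divide complex_norm_square[symmetric] power2_eq_square
        simp flip: of_real_mult)
  then have d: "b1 * cnj b0 = a1 * cnj a0" by (simp add: d_def)
  then have prod: "cmod b1 * cmod b0 = cmod a1 * cmod a0"
    by (metis complex_mod_cnj norm_mult)
  show ?thesis
  proof (cases "cmod a1 = cmod b1")
    case True
    then have 0: "cmod a0 = cmod b0" using eq by (simp add: power2_eq_imp_eq)
    show ?thesis
    proof (cases "b1 = 0")
      case True
      with \<open>cmod a1 = cmod b1\<close> have "a1 = 0" by simp
      show ?thesis
      proof (cases "b0 = 0")
        case True
        with \<open>b1 = 0\<close> \<open>a1 = 0\<close> 0 show ?thesis by (intro disjI1 exI[of _ 1]) auto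
      next
        case False
        with \<open>b1 = 0\<close> \<open>a1 = 0\<close> 0 show ?thesis
          by (intro disjI1 exI[of _ "a0 / b0"]) (auto simp: norm_divide)
      qed
    next
      case False
      define \<eta> where "\<eta> = a1 / b1"
      have \<eta>: "cmod \<eta> = 1" "a1 = \<eta> * b1"
        using False \<open>cmod a1 = cmod b1\<close> by (auto simp: \<eta>_def norm_divide)
      have "cnj b0 = \<eta> * cnj a0" using d False by (simp add: \<eta>_def field_simps)
      then have "b0 = cnj \<eta> * a0" by (metis complex_cnj_cnj complex_cnj_mult)
      then have "\<eta> * b0 = a0"
        using complex_norm_square[of \<eta>] \<eta>(1) by simp
      with \<eta> show ?thesis by blast
    qed
  next
    case False
    then have lt: "cmod a1 < cmod b1" using a1 by simp
    have b1: "b1 \<noteq> 0" using lt by auto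
    \<comment> \<open>The squared modulus of \<open>b1\<close> is a root of the quadratic whose
      roots are those of \<open>a0\<close> and \<open>a1\<close>.\<close>
    have "((cmod a0)\<^sup>2 - (cmod b1)\<^sup>2) * ((cmod b1)\<^sup>2 - (cmod a1)\<^sup>2) = 0"
      using eq prod by algebra
    moreover have "(cmod a1)\<^sup>2 < (cmod b1)\<^sup>2"
      using lt by (simp add: power_strict_mono)
    ultimately have 0: "cmod a0 = cmod b1"
      using lt by (auto simp: power2_eq_iff_nonneg)
    have "b0 * cnj b1 = a0 * cnj a1"
      using arg_cong[OF d, of cnj] by (simp add: mult.commute)
    then have "b0 = b1 * (cnj (a1 / b1) * (a0 / b1))"
      using b1 by (simp add: field_simps)
    with 0 lt b1 show ?thesis
      by (intro disjI2 exI[of _ "a0 / b1"] exI[of _ "a1 / b1"]) (auto simp: norm_divide)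
  qed
qed

subsection \<open>The case of equality\<close>

lemma powser_affine:
  assumes "\<And>n. n \<ge> 2 \<Longrightarrow> a n = 0"
  shows "powser a z = a 0 + a 1 * z"
proof -
  have "a n * z ^ n = 0" if "n \<notin> {0, 1}" for n
  proof -
    have "n \<ge> 2" using that by auto
    then show ?thesis by (simp add: assms)
  qed
  then have "powser a z = (\<Sum>n\<in>{0, 1}. a n * z ^ n)"
    unfolding powser_def by (intro suminf_finite) auto
  then show ?thesis by simp
qed

text \<open>The case of a \<open>g\<close> that is not identically 0, in which the quotient is
  available.\<close>

lemma dominated_fock:
  assumes f: "f \<in> fock_space" and g: "g \<in> fock_space"
    and le: "\<And>z. cmod z > 1 \<Longrightarrow> cmod (f z) \<le> cmod (g z)" and nz: "g \<beta> \<noteq> 0"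
  shows "fock_norm f \<le> fock_norm g"
    and "fock_norm f = fock_norm g \<Longrightarrow>
      (\<exists>\<eta>. cmod \<eta> = 1 \<and> (\<forall>z. f z = \<eta> * g z)) \<or>
      (\<exists>c \<eta> a. cmod \<eta> = 1 \<and> cmod a < 1 \<and>
         (\<forall>z. f z = c * (\<eta> + a * z) \<and> g z = c * (z + cnj a * \<eta>)))"
proof -
  have hol: "f holomorphic_on UNIV" "g holomorphic_on UNIV"
    using f g by (auto simp: fock_space_def)
  obtain a where ha: "entire_coeffs a" "f = powser a" using entire_powser[OF hol(1)] .
  obtain b where hb: "entire_coeffs b" "g = powser b" using entire_powser[OF hol(2)] .
  obtain S where hS: "S holomorphic_on ball 0 1" "\<And>w. w \<in> ball 0 1 \<Longrightarrow> cmod (S w) \<le> 1"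
    "\<And>w. w \<in> ball 0 1 - {0} \<Longrightarrow> f (1 / w) = S w * g (1 / w)"
    using quotient_at_infinity[OF hol nz le] by blast
  interpret dominated_pair a b S
    by unfold_locales (use ha hb hS in auto)
  define T where "T m = (\<Sum>n. p (n + m))" for m
  define c :: "nat \<Rightarrow> real" where "c m = fact m - (case m of 0 \<Rightarrow> 0 | Suc n \<Rightarrow> fact n)" for m
  have c: "0 \<le> c m" for m
    by (auto simp: c_def fact_mono split: nat.split)
  have T: "0 \<le> T m" for m
    unfolding T_def by (rule tail_sum_nonneg)
  have na: "(\<lambda>n. fact n * (cmod (a n))\<^sup>2) sums (fock_norm f)\<^sup>2"
    and nb: "(\<lambda>n. fact n * (cmod (b n))\<^sup>2) sums (fock_norm g)\<^sup>2"
    using fock_norm_powser[OF ha(1)] fock_norm_powser[OF hb(1)] f g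
    unfolding ha(2)[symmetric] hb(2)[symmetric] by blast+
  have "(\<lambda>n. fact n * p n) sums ((fock_norm g)\<^sup>2 - (fock_norm f)\<^sup>2)"
    using sums_diff[OF nb na] by (simp add: p_def right_diff_distrib)
  then have main: "(\<lambda>m. c m * T m) sums ((fock_norm g)\<^sup>2 - (fock_norm f)\<^sup>2)"
    using sum_fact_by_tails[OF sums_summable[OF na] sums_summable[OF nb]]
    by (simp add: c_def T_def sums_iff)
  have fg0: "0 \<le> fock_norm f" "0 \<le> fock_norm g"
    by (simp_all add: fock_norm_def)
  have "0 \<le> (\<Sum>m. c m * T m)"
    by (rule suminf_nonneg[OF sums_summable[OF main]]) (simp add: c T)
  then have "(fock_norm f)\<^sup>2 \<le> (fock_norm g)\<^sup>2"
    unfolding sums_unique[OF main, symmetric] by simp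
  then show "fock_norm f \<le> fock_norm g"
    using fg0(2) by (rule power2_le_imp_le)
  show "(\<exists>\<eta>. cmod \<eta> = 1 \<and> (\<forall>z. f z = \<eta> * g z)) \<or>
      (\<exists>c \<eta> a. cmod \<eta> = 1 \<and> cmod a < 1 \<and>
         (\<forall>z. f z = c * (\<eta> + a * z) \<and> g z = c * (z + cnj a * \<eta>)))"
    if eq: "fock_norm f = fock_norm g"
  proof -
    have cT: "c m * T m = 0" for m
    proof -
      have "(\<Sum>m. c m * T m) = 0"
        using sums_unique[OF main] eq by simp
      then show ?thesis
        using suminf_eq_zero_iff[OF sums_summable[OF main]] c T by simp
    qed
    have c_pos: "c m > 0" if "m \<noteq> 1" for m
    proof (cases m)
      case (Suc n)
      with that have "(fact n :: real) < fact m" by (intro fact_less_mono) auto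
      with Suc show ?thesis by (simp add: c_def)
    qed (simp add: c_def)
    \<comment> \<open>The weight \<open>c 1\<close> is 0, so \<open>T 1\<close> stays free; this
      freedom is the source of the second family.\<close>
    have T0: "T m = 0" if "m \<noteq> 1" for m
      using cT[of m] c_pos[OF that] by simp
    have Tsplit: "T m = p m + T (Suc m)" for m
      using suminf_split_head[of "\<lambda>n. p (n + m)"] summable_p[of 1]
      by (simp add: T_def summable_iff_shift)
    have p0: "p n = 0" if "n \<ge> 2" for n
      using Tsplit[of n] T0 that by simp
    \<comment> \<open>Since \<open>T 2 = 0\<close>, the number \<open>p 1\<close> is the nonnegative
      tail sum \<open>T 1\<close>.\<close>
    have p1: "0 \<le> p 1"
      using Tsplit[of 1] T[of 1] T0[of 2] by (simp add: numeral_2_eq_2)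
    have p01: "p 0 + p 1 = 0"
      using Tsplit[of 0] Tsplit[of 1] T0[of 0] T0[of 2] by (simp add: numeral_2_eq_2)
    show ?thesis
    proof (cases "\<exists>m\<ge>2. b m \<noteq> 0")
      case True
      then obtain m where m: "m \<ge> 2" "b m \<noteq> 0" by blast
      define \<kappa> where "\<kappa> = a m / b m"
      have \<kappa>: "cmod \<kappa> = 1" "a n = \<kappa> * b n" for n
        using proportional[OF p0 m] unfolding \<kappa>_def by blast+
      have "f z = \<kappa> * g z" for z
        using sums_mult[OF sums_powser[OF hb(1)], of \<kappa> z] unfolding ha(2) hb(2) powser_def[of a]
        by (simp add: \<kappa>(2) mult.assoc sums_iff)
      with \<kappa>(1) show ?thesis by blast
    next
      case False
      have a0: "a n = 0" if "n \<ge> 2" for n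
        using p0[OF that] False that by (simp add: p_def)
      have fz: "f z = a 0 + a 1 * z" and gz: "g z = b 0 + b 1 * z" for z
        unfolding ha(2) hb(2) by (rule powser_affine, use a0 False in blast)+
      have "(\<exists>\<eta>. cmod \<eta> = 1 \<and> a 0 = \<eta> * b 0 \<and> a 1 = \<eta> * b 1) \<or>
          (\<exists>\<eta> d. cmod \<eta> = 1 \<and> cmod d < 1 \<and> a 0 = b 1 * \<eta> \<and> a 1 = b 1 * d \<and> b 0 = b 1 * (cnj d * \<eta>))"
      proof (rule affine_pair)
        show "cmod (a 0 + a 1 * z) \<le> cmod (b 0 + b 1 * z)" if "cmod z > 1" for z
          using le[OF that] by (simp add: fz gz)
        show "(cmod (a 0))\<^sup>2 + (cmod (a 1))\<^sup>2 = (cmod (b 0))\<^sup>2 + (cmod (b 1))\<^sup>2"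
          using p01 by (simp add: p_def)
        show "cmod (a 1) \<le> cmod (b 1)"
          using p1 by (simp add: p_def power_mono_iff)
      qed
      then show ?thesis
      proof (elim disjE exE conjE)
        fix \<eta> assume "cmod \<eta> = 1" "a 0 = \<eta> * b 0" "a 1 = \<eta> * b 1"
        then show ?thesis
          by (intro disjI1 exI[of _ \<eta>]) (simp add: fz gz algebra_simps)
      next
        fix \<eta> d assume "cmod \<eta> = 1" "cmod d < 1" "a 0 = b 1 * \<eta>" "a 1 = b 1 * d" "b 0 = b 1 * (cnj d * \<eta>)"
        then show ?thesis
          unfolding fz gz by (intro disjI2 exI[of _ "b 1"] exI[of _ \<eta>] exI[of _ d]) (simp add: algebra_simps)
      qed
    qed
  qed
qed

theorem theorem1p1:
  fixes f g :: "complex \<Rightarrow> complex"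
  assumes "f \<in> fock_space" and "g \<in> fock_space"
    and "\<And>z. cmod z > 1 \<Longrightarrow> cmod (f z) \<le> cmod (g z)"
  shows "fock_norm f \<le> fock_norm g \<and>
    (fock_norm f = fock_norm g \<longleftrightarrow>
      (\<exists>\<eta>. cmod \<eta> = 1 \<and> (\<forall>z. f z = \<eta> * g z)) \<or>
      (\<exists>c \<eta> a. cmod \<eta> = 1 \<and> cmod a < 1 \<and>
         (\<forall>z. f z = c * (\<eta> + a * z) \<and> g z = c * (z + cnj a * \<eta>))))"
    (is "_ \<and> (_ \<longleftrightarrow> ?R)")
proof -
  \<comment> \<open>In the first alternative the integrands agree; in the second both squared norms
    are the squared modulus of \<open>c\<close> times 1 plus that of \<open>a\<close>.\<close>
  have conv: "fock_norm f = fock_norm g" if ?R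
    using that
  proof (elim disjE exE conjE)
    fix \<eta> assume "cmod \<eta> = 1" "\<forall>z. f z = \<eta> * g z"
    then show ?thesis by (simp add: fock_norm_def norm_mult)
  next
    fix c \<eta> a assume \<eta>: "cmod \<eta> = 1" and fg: "\<forall>z. f z = c * (\<eta> + a * z) \<and> g z = c * (z + cnj a * \<eta>)"
    have "fock_norm f = sqrt ((cmod (c * \<eta>))\<^sup>2 + (cmod (c * a))\<^sup>2)"
      by (rule fock_norm_affine[OF _ assms(1)]) (simp add: fg algebra_simps)
    moreover have "fock_norm g = sqrt ((cmod (c * (cnj a * \<eta>)))\<^sup>2 + (cmod c)\<^sup>2)"
      by (rule fock_norm_affine[OF _ assms(2)]) (simp add: fg algebra_simps)
    ultimately show ?thesis using \<eta> by (simp add: norm_mult add.commute)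
  qed
  show ?thesis
  proof (cases "\<exists>\<beta>. g \<beta> \<noteq> 0")
    case True
    then obtain \<beta> where "g \<beta> \<noteq> 0" by blast
    note dom = dominated_fock[OF assms this]
    show ?thesis using dom conv by blast
  next
    \<comment> \<open>If \<open>g\<close> is identically 0, then \<open>f\<close> vanishes outside
      the closed disc. Parseval's identity on the circle of radius 2 gives \<open>f = 0\<close>,
      which is the first alternative with constant 1.\<close>
    case False
    then have g0: "g z = 0" for z by blast
    then obtain a where a: "entire_coeffs a" "f = powser a"
      using entire_powser[of f] assms(1) by (auto simp: fock_space_def)
    have "(\<lambda>n. (cmod (a n))\<^sup>2 * cmod 2 ^ (2 * n)) sums circle_mean (\<lambda>x. (cmod (powser a (2 * x)))\<^sup>2)"
      by (rule parseval[OF a(1)])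
    also have "circle_mean (\<lambda>x. (cmod (powser a (2 * x)))\<^sup>2) = circle_mean (\<lambda>x. 0)"
      by (rule circle_mean_cong)
        (use assms(3)[of "2 * _"] in \<open>simp add: a(2)[symmetric] g0 norm_mult\<close>)
    finally have "(\<lambda>n. (cmod (a n))\<^sup>2 * cmod 2 ^ (2 * n)) sums 0" by simp
    then have "a n = 0" for n
      using suminf_eq_zero_iff[of "\<lambda>n. (cmod (a n))\<^sup>2 * cmod 2 ^ (2 * n)"] by (simp add: sums_iff)
    then have "\<forall>z. f z = 1 * g z"
      by (simp add: a(2) powser_def g0)
    then have ?R by (intro disjI1 exI[of _ 1]) simp
    with conv show ?thesis by simp
  qed
qed

end
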